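(* Let $k>1$ and let $\gamma\in\mathbb{R}$ be an integer or a half-integer (i.e. $2\gamma\in\mathbb{Z}$). Then the Askey/Berg density $f_\gamma$ on $(0,\infty)$, given by $$f_\gamma(y)\propto \frac{y^{\gamma-1}}{L_k(y)},\qquad L_k(y)=\sum_{n=-\infty}^{\infty}y^n k^{-\frac12 n^2},\qquad y>0,$$ is doubly symmetric: it is log-symmetric with constant $\delta=k^{\gamma}$ and R-symmetric with constant $\theta=k^{\gamma-1}$.
   Context: The symbol $\propto$ means that $f_\gamma$ is normalised to be a probability density on $(0,\infty)$. A probability density $f$ on $(0,\infty)$ is log-symmetric with constant $\delta>0$ if $y^2 f(\delta y)=f(\delta/y)$ for all $y>0$, and R-symmetric with constant $\theta>0$ if $f(\theta y)=f(\theta/y)$ for all $y>0$. It is doubly symmetric if it is both log-symmetric (for some $\delta$) and R-symmetric (for some $\theta$). *)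

theory Defs
  imports "HOL-Analysis.Analysis"
begin

(* Functions on the positive half-line are total functions real => real; every notion below only
   looks at their values at positive arguments. *)

definition pos_prob_density :: "(real \<Rightarrow> real) \<Rightarrow> bool" where
  "pos_prob_density f \<longleftrightarrow>
     (\<forall>y>0. f y \<ge> 0) \<and> set_integrable lborel {0<..} f \<and> (LBINT y:{0<..}. f y) = 1"

definition log_symmetric :: "real \<Rightarrow> (real \<Rightarrow> real) \<Rightarrow> bool" where
  "log_symmetric \<delta> f \<longleftrightarrow>
     pos_prob_density f \<and> \<delta> > 0 \<and> (\<forall>y>0. y^2 * f (\<delta> * y) = f (\<delta> / y))"

definition R_symmetric :: "real \<Rightarrow> (real \<Rightarrow> real) \<Rightarrow> bool" where
  "R_symmetric \<theta> f \<longleftrightarrow>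
     pos_prob_density f \<and> \<theta> > 0 \<and> (\<forall>y>0. f (\<theta> * y) = f (\<theta> / y))"

definition doubly_symmetric :: "(real \<Rightarrow> real) \<Rightarrow> bool" where
  "doubly_symmetric f \<longleftrightarrow> (\<exists>\<delta>. log_symmetric \<delta> f) \<and> (\<exists>\<theta>. R_symmetric \<theta> f)"

definition askey_berg_L :: "real \<Rightarrow> real \<Rightarrow> real" where
  "askey_berg_L k y = (\<Sum>\<^sub>\<infinity>n::int. y powi n * k powr (- (1/2) * (real_of_int n)^2))"

definition askey_berg_kernel :: "real \<Rightarrow> real \<Rightarrow> real \<Rightarrow> real" where
  "askey_berg_kernel k \<gamma> y = y powr (\<gamma> - 1) / askey_berg_L k y"

(* If the kernel were not integrable, the conventional value 0 of the integral would make this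
   function vanish, so it would not satisfy pos_prob_density. *)
definition askey_berg_density :: "real \<Rightarrow> real \<Rightarrow> real \<Rightarrow> real" where
  "askey_berg_density k \<gamma> y =
     askey_berg_kernel k \<gamma> y / (LBINT t:{0<..}. askey_berg_kernel k \<gamma> t)"

end

theory Submission
  imports Defs "HOL-Library.Nat_Bijection"
begin

text \<open>The theta-like function \<open>L\<close> is invariant under \<open>y \<mapsto> 1 / y\<close>, and completing the square shows
  \<open>L (k\<^sup>m y) = k powr (m\<^sup>2 / 2) y\<^sup>m L y\<close> for integers \<open>m\<close>.  Hence, for \<open>2 c = m\<close> an integer,
  \<open>L (k\<^sup>c y) = y\<^sup>m L (k\<^sup>c / y)\<close>; the cases \<open>c = \<gamma>\<close> and \<open>c = \<gamma> - 1\<close> are the two symmetries.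
  The density is integrable because \<open>L\<close> dominates each single term of its series, that is, every
  power of \<open>y\<close> at \<open>0\<close> and at infinity.\<close>

section \<open>Convergence and positivity of the theta series\<close>

lemma summable_on_power_nat_abs:
  fixes q :: real
  assumes "0 \<le> q" "q < 1"
  shows "(\<lambda>n::int. q ^ nat \<bar>n\<bar>) summable_on UNIV"
proof -
  have geometric: "(\<lambda>n. q ^ n) summable_on (UNIV :: nat set)"
    using assms by (intro norm_summable_imp_summable_on) simp
  have reindex: "(\<lambda>n::int. q ^ nat \<bar>n\<bar>) summable_on (range h)"
    if "inj h" "\<And>n. nat \<bar>h n\<bar> = n" for h :: "nat \<Rightarrow> int"
    using geometric that by (simp add: summable_on_reindex o_def)
  \<comment> \<open>Both half-lines contain 0, so it is removed from the second one to make the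
    union disjoint.\<close>
  have "(\<lambda>n::int. q ^ nat \<bar>n\<bar>) summable_on (range int \<union> (range (\<lambda>n. - int n) - range int))"
    by (intro summable_on_Un_disjoint reindex
          summable_on_subset_banach[OF reindex[of "\<lambda>n. - int n"]]) (auto simp: inj_def)
  moreover have "range int \<union> (range (\<lambda>n. - int n) - range int) = UNIV"
  proof -
    have "m \<in> range int \<union> range (\<lambda>n. - int n)" for m :: int
      by (cases m rule: int_cases2) auto
    then show ?thesis by blast
  qed
  ultimately show ?thesis by simp
qed

text \<open>With each term a single power of \<open>k\<close>, bounding terms reduces to comparing
  exponents.\<close>

lemma askey_berg_term_eq_powr:
  fixes k y :: real
  assumes "k > 1" "y > 0"
  shows "y powi n * k powr (- (1/2) * (real_of_int n)^2)
    = k powr (log k y * real_of_int n - (real_of_int n)^2 / 2)"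
proof -
  have "k powr (log k y * real_of_int n) = y powi n"
    using assms by (simp add: powr_real_of_int' flip: powr_powr)
  then show ?thesis
    by (simp add: powr_diff powr_minus_divide)
qed

text \<open>The quadratic part of the exponent beats the linear one, which leaves a geometric
  majorant of ratio \<open>1/k\<close>.\<close>

lemma askey_berg_L_summable:
  fixes k y :: real
  assumes "k > 1" "y > 0"
  shows "(\<lambda>n::int. y powi n * k powr (- (1/2) * (real_of_int n)^2)) summable_on UNIV"
proof -
  define t where "t = log k y"
  \<comment> \<open>The exponent of \<open>C\<close> bounds
    \<open>(\<bar>t\<bar> + 1) * \<bar>n\<bar> - n^2 / 2\<close> for every \<open>n\<close>; the
    extra 1 pays for the factor \<open>(1/k) ^ nat \<bar>n\<bar>\<close>.\<close>
  define C where "C = k powr ((\<bar>t\<bar> + 1)^2 / 2)"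
  have bound: "y powi n * k powr (- (1/2) * (real_of_int n)^2) \<le> C * (1/k) ^ nat \<bar>n\<bar>" for n :: int
  proof -
    have "t * real_of_int n \<le> \<bar>t\<bar> * \<bar>real_of_int n\<bar>"
      by (metis abs_ge_self abs_mult)
    moreover have "0 \<le> (\<bar>real_of_int n\<bar> - (\<bar>t\<bar> + 1))^2" by simp
    ultimately have "t * real_of_int n - (real_of_int n)^2 / 2
        \<le> (\<bar>t\<bar> + 1)^2 / 2 - \<bar>real_of_int n\<bar>"
      by (simp add: power2_eq_square algebra_simps)
    moreover have "k powr \<bar>real_of_int n\<bar> = k ^ nat \<bar>n\<bar>"
      using assms by (simp flip: powr_realpow)
    then have "C * (1/k) ^ nat \<bar>n\<bar> = k powr ((\<bar>t\<bar> + 1)^2 / 2 - \<bar>real_of_int n\<bar>)"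
      by (simp add: C_def powr_diff power_one_over)
    ultimately show ?thesis
      unfolding askey_berg_term_eq_powr[OF assms] t_def[symmetric] using assms by simp
  qed
  show ?thesis
  proof (rule summable_on_comparison_test)
    show "(\<lambda>n::int. C * (1/k) ^ nat \<bar>n\<bar>) summable_on UNIV"
      using assms by (intro summable_on_cmult_right summable_on_power_nat_abs) auto
  qed (use bound assms in auto)
qed

text \<open>All terms are nonnegative, so a one-element partial sum is at most the whole sum. The
  index 0 gives positivity of the series, other indices the decay of the kernel.\<close>

lemma askey_berg_term_le_L:
  fixes k y :: real
  assumes "k > 1" "y > 0"
  shows "y powi n * k powr (- (1/2) * (real_of_int n)^2) \<le> askey_berg_L k y"
  using finite_sum_le_infsum[OF askey_berg_L_summable[OF assms], of "{n}"] assms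
  by (simp add: askey_berg_L_def)

lemma askey_berg_L_pos:
  fixes k y :: real
  assumes "k > 1" "y > 0"
  shows "askey_berg_L k y > 0"
  using askey_berg_term_le_L[OF assms, of 0] assms by simp

section \<open>Functional equations of the series and the kernel\<close>

lemma askey_berg_L_inverse: "askey_berg_L k (1 / y) = askey_berg_L k y"
proof -
  have "(1 / y) powi n = y powi (- n)" for n
    by (simp add: power_int_minus power_int_inverse divide_inverse)
  note reflect = this
  have "bij (uminus :: int \<Rightarrow> int)" by (rule bij_uminus)
  from infsum_reindex_bij_betw[OF this,
      where f = "\<lambda>n. y powi n * k powr (- (1/2) * (real_of_int n)^2)"]
  show ?thesis
    by (simp add: askey_berg_L_def reflect)
qed

text \<open>Replace the index \<open>n\<close> by \<open>n + m\<close> and use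
  \<open>m * (n + m) - (n + m)^2 / 2 = m^2 / 2 - n^2 / 2\<close>.\<close>

lemma askey_berg_L_shift:
  fixes k y :: real
  assumes "k > 1" "y > 0"
  shows "askey_berg_L k (k powi m * y)
    = k powr ((real_of_int m)^2 / 2) * y powi m * askey_berg_L k y"
proof -
  define f where "f n = y powi n * k powr (- (1/2) * (real_of_int n)^2)" for n :: int
  have term_shift: "(k powi m * y) powi (n + m) * k powr (- (1/2) * (real_of_int (n + m))^2)
      = k powr ((real_of_int m)^2 / 2) * y powi m * f n" for n
  proof -
    let ?E = "\<lambda>j. k powr (- (1/2) * (real_of_int j)^2)"
    have "(k powi m) powi (n + m) = k powr (real_of_int m * real_of_int (n + m))"
      using assms by (simp add: powr_real_of_int'[symmetric] powr_powr)
    moreover have "k powr (real_of_int m * real_of_int (n + m)) * ?E (n + m)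
        = k powr ((real_of_int m)^2 / 2) * ?E n"
      unfolding powr_add[symmetric]
      by (rule arg_cong[where f = "(powr) k"]) (simp add: power2_eq_square field_simps)
    ultimately have complete_square:
      "(k powi m) powi (n + m) * ?E (n + m) = k powr ((real_of_int m)^2 / 2) * ?E n"
      by (simp only:)
    have "(k powi m * y) powi (n + m) = (k powi m) powi (n + m) * (y powi n * y powi m)"
      using assms by (simp add: power_int_mult_distrib power_int_add[of y])
    then have "(k powi m * y) powi (n + m) * ?E (n + m)
        = ((k powi m) powi (n + m) * ?E (n + m)) * (y powi n * y powi m)"
      by (simp only: mult_ac)
    then show ?thesis
      unfolding complete_square f_def by (simp only: mult_ac)
  qed
  have "bij (\<lambda>n::int. n + m)" by (rule bij_plus_right)
  from infsum_reindex_bij_betw[OF this, where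
      f = "\<lambda>n. (k powi m * y) powi n * k powr (- (1/2) * (real_of_int n)^2)"]
  have "askey_berg_L k (k powi m * y) = (\<Sum>\<^sub>\<infinity>n. k powr ((real_of_int m)^2 / 2) * y powi m * f n)"
    unfolding term_shift askey_berg_L_def by simp
  then show ?thesis
    by (simp add: infsum_cmult_right' f_def askey_berg_L_def)
qed

lemma askey_berg_L_reflect:
  fixes k y c :: real
  assumes "k > 1" "y > 0" "2 * c \<in> \<int>"
  shows "askey_berg_L k (k powr c * y) = y powr (2 * c) * askey_berg_L k (k powr c / y)"
proof -
  from assms(3) obtain m where m: "2 * c = real_of_int m" by (elim Ints_cases)
  \<comment> \<open>As \<open>c\<close> may be a half-integer, the shift is by
    \<open>m = 2 * c\<close> and starts from \<open>x\<close>: then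
    \<open>k powi m * x = k powr c * y\<close>, while \<open>1 / x = k powr c / y\<close>.\<close>
  define x where "x = y / k powr c"
  have "x > 0" using assms by (simp add: x_def)
  have "k powi m * x = k powr c * y"
    using assms by (simp add: x_def powr_real_of_int'[symmetric] m[symmetric] field_simps
        flip: powr_add)
  moreover have "k powr ((real_of_int m)^2 / 2) * x powi m = y powr (2 * c)"
  proof -
    have "x powi m = y powr (2 * c) / k powr (c * (2 * c))"
      using assms \<open>x > 0\<close>
      by (simp add: powr_real_of_int'[symmetric] m[symmetric] x_def powr_divide powr_powr)
    moreover have "(real_of_int m)^2 / 2 = c * (2 * c)"
      by (simp add: m[symmetric] power2_eq_square)
    ultimately show ?thesis using assms by (simp only:) simp
  qed
  ultimately have "askey_berg_L k (k powr c * y) = y powr (2 * c) * askey_berg_L k x"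
    using askey_berg_L_shift[OF assms(1) \<open>x > 0\<close>, of m] by simp
  then show ?thesis
    using askey_berg_L_inverse[of k x] by (simp add: x_def)
qed

text \<open>Passing from \<open>k powr c / y\<close> to \<open>k powr c * y\<close> multiplies the
  numerator by \<open>y powr (2 * (\<gamma> - 1))\<close> and the series by
  \<open>y powr (2 * c)\<close>. The prefactor is \<open>y^2\<close> for \<open>c = \<gamma>\<close>
  and 1 for \<open>c = \<gamma> - 1\<close>.\<close>

lemma askey_berg_kernel_reflect:
  fixes k y c \<gamma> :: real
  assumes "k > 1" "y > 0" "2 * c \<in> \<int>"
  shows "y powr (2 * (c - \<gamma> + 1)) * askey_berg_kernel k \<gamma> (k powr c * y)
    = askey_berg_kernel k \<gamma> (k powr c / y)"
proof -
  have "y powr (2 * (c - \<gamma> + 1)) * y powr (\<gamma> - 1) / y powr (2 * c) = 1 / y powr (\<gamma> - 1)"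
    using assms by (simp add: divide_simps flip: powr_add)
  then show ?thesis
    unfolding askey_berg_kernel_def askey_berg_L_reflect[OF assms]
    using assms by (simp add: powr_mult powr_divide field_simps)
qed

section \<open>Measurability and integrability of the kernel\<close>

lemma borel_measurable_powi [measurable]: "(\<lambda>y::real. y powi n) \<in> borel_measurable borel"
  unfolding power_int_def by measurable

lemma askey_berg_kernel_measurable:
  fixes k :: real
  assumes "k > 1"
  shows "set_borel_measurable lborel {0<..} (askey_berg_kernel k \<gamma>)"
proof -
  \<comment> \<open>Enumerating the integers by \<open>int_decode\<close> turns the
    \<open>infsum\<close> into an ordinary series, whose measurability follows from that of its
    terms.\<close>
  define g where "g y i = (let n = int_decode i in
    y powi n * k powr (- (1/2) * (real_of_int n)^2))" for y i
  have L_eq: "askey_berg_L k y = (\<Sum>i. g y i)" if "y > 0" for y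
  proof -
    have "(g y) summable_on UNIV"
      using askey_berg_L_summable[OF assms that]
      unfolding g_def Let_def
      by (subst summable_on_reindex_bij_betw[OF bij_int_decode])
    then have "(g y has_sum infsum (g y) UNIV) UNIV" by simp
    then have "(\<Sum>i. g y i) = infsum (g y) UNIV"
      by (metis has_sum_imp_sums sums_unique)
    also have "\<dots> = askey_berg_L k y"
      unfolding askey_berg_L_def g_def Let_def
      by (rule infsum_reindex_bij_betw) (rule bij_int_decode)
    finally show ?thesis by simp
  qed
  have [measurable]: "(\<lambda>y. \<Sum>i. g y i) \<in> borel_measurable borel"
    unfolding g_def Let_def by measurable
  have "(\<lambda>y. indicator {0<..} y *\<^sub>R (y powr (\<gamma> - 1) / (\<Sum>i. g y i))) \<in> borel_measurable lborel"
    by measurable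
  \<comment> \<open>The two forms of the series are identified only for positive \<open>y\<close>;
    elsewhere the indicator makes both sides 0.\<close>
  moreover have "indicator {0<..} y *\<^sub>R (y powr (\<gamma> - 1) / (\<Sum>i. g y i))
      = indicator {0<..} y *\<^sub>R askey_berg_kernel k \<gamma> y" for y
    by (cases "y > 0") (simp_all add: askey_berg_kernel_def L_eq)
  ultimately show ?thesis unfolding set_borel_measurable_def by (simp only:)
qed

lemma askey_berg_kernel_pos:
  fixes k y :: real
  assumes "k > 1" "y > 0"
  shows "askey_berg_kernel k \<gamma> y > 0"
  using askey_berg_L_pos[OF assms] assms by (simp add: askey_berg_kernel_def)

text \<open>Keeping a single term of the series in the denominator bounds the kernel by a power of
  \<open>y\<close>; the index \<open>n\<close> is free and sets the exponent.\<close>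

lemma askey_berg_kernel_le:
  fixes k y \<gamma> :: real
  assumes "k > 1" "y > 0"
  shows "askey_berg_kernel k \<gamma> y
    \<le> k powr ((real_of_int n)^2 / 2) * y powr (\<gamma> - 1 - real_of_int n)"
proof -
  have "askey_berg_kernel k \<gamma> y
      \<le> y powr (\<gamma> - 1) / (y powi n * k powr (- (1/2) * (real_of_int n)^2))"
    unfolding askey_berg_kernel_def
    using askey_berg_term_le_L[OF assms, of n] askey_berg_L_pos[OF assms] assms
    by (intro divide_left_mono) auto
  also have "\<dots> = k powr ((real_of_int n)^2 / 2) * y powr (\<gamma> - 1 - real_of_int n)"
  proof -
    have powr_shift: "y powr (\<gamma> - 1 - real_of_int n) = y powr (\<gamma> - 1) / y powi n"
      using assms by (simp add: powr_diff[of y "\<gamma> - 1"] powr_real_of_int')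
    have weight: "k powr (- (1/2) * (real_of_int n)^2) = 1 / k powr ((real_of_int n)^2 / 2)"
      by (simp flip: powr_minus_divide)
    show ?thesis
      unfolding powr_shift weight by simp
  qed
  finally show ?thesis .
qed

lemma askey_berg_kernel_integrable:
  fixes k \<gamma> :: real
  assumes "k > 1"
  shows "set_integrable lborel {0<..} (askey_berg_kernel k \<gamma>)"
proof -
  have measurable_on: "set_borel_measurable lborel A (askey_berg_kernel k \<gamma>)"
    if "A \<in> sets borel" "A \<subseteq> {0<..}" for A
    by (rule set_borel_measurable_subset[OF askey_berg_kernel_measurable[OF assms]])
      (use that in simp_all)
  have "set_integrable lborel {0<..1} (askey_berg_kernel k \<gamma>)"
  proof -
    \<comment> \<open>The exponent \<open>\<gamma> - 1 - n\<close> becomes the fractional part of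
      \<open>\<gamma>\<close>, which is nonnegative, so the power of \<open>y\<close> is at most 1
      here.\<close>
    define n where "n = \<lfloor>\<gamma>\<rfloor> - 1"
    define C where "C = k powr ((real_of_int n)^2 / 2)"
    have "askey_berg_kernel k \<gamma> y \<le> C" if "y \<in> {0<..1}" for y
    proof -
      have "y powr (\<gamma> - 1 - real_of_int n) \<le> 1"
        using that by (intro powr_le1) (auto simp: n_def)
      then have "C * y powr (\<gamma> - 1 - real_of_int n) \<le> C"
        by (simp add: C_def mult_left_le)
      then show ?thesis
        using askey_berg_kernel_le[OF assms, of y \<gamma> n] that by (simp add: C_def)
    qed
    moreover have "set_integrable lborel {0<..1::real} (\<lambda>_. C)"
      by (simp add: set_integrable_def)
    ultimately show ?thesis
      using askey_berg_kernel_pos[OF assms, of _ \<gamma>]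
      by (intro set_integrable_bound[OF _ measurable_on, of _ "\<lambda>_. C"])
        (auto simp: less_imp_le C_def)
  qed
  moreover have "set_integrable lborel {1<..} (askey_berg_kernel k \<gamma>)"
  proof -
    \<comment> \<open>The exponent becomes \<open>\<gamma> - \<lceil>\<gamma>\<rceil> - 2\<close>,
      which is at most -2, so the bound is integrable at infinity.\<close>
    define n where "n = \<lceil>\<gamma>\<rceil> + 1"
    define C where "C = k powr ((real_of_int n)^2 / 2)"
    have "askey_berg_kernel k \<gamma> y \<le> C * y powr (-2)" if "y \<in> {1<..}" for y
    proof -
      have "y powr (\<gamma> - 1 - real_of_int n) \<le> y powr (-2)"
        using that le_of_int_ceiling[of \<gamma>] by (intro powr_mono) (auto simp: n_def)
      then have "C * y powr (\<gamma> - 1 - real_of_int n) \<le> C * y powr (-2)"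
        by (intro mult_left_mono) (auto simp: C_def)
      then show ?thesis
        using askey_berg_kernel_le[OF assms, of y \<gamma> n] that by (simp add: C_def)
    qed
    moreover have "set_integrable lborel {1<..} (\<lambda>y::real. C * y powr (-2))"
    proof -
      have "(\<lambda>y::real. y powr (-2)) absolutely_integrable_on {1..}"
        using has_integral_powr_to_inf[of "-2" 1]
        by (intro nonnegative_absolutely_integrable_1) (auto simp: integrable_on_def)
      \<comment> \<open>Absolute integrability refers to the completed measure; a Borel measurable
        integrand allows the return to \<open>lborel\<close>.\<close>
      then have "set_integrable lborel {1..} (\<lambda>y::real. y powr (-2))"
        by (simp add: set_integrable_def integrable_completion)
      then show ?thesis
        by (intro set_integrable_mult_right, rule set_integrable_subset) auto
    qed
    ultimately show ?thesis
      using askey_berg_kernel_pos[OF assms, of _ \<gamma>]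
      by (intro set_integrable_bound[OF _ measurable_on, of _ "\<lambda>y. C * y powr (-2)"])
        (auto simp: less_imp_le C_def)
  qed
  moreover have "{0<..} = {0<..1} \<union> {1::real<..}" by auto
  ultimately show ?thesis
    by (metis set_integrable_Un greaterThanAtMost_borel greaterThan_borel sets_lborel)
qed

section \<open>Normalisation and the two symmetries\<close>

lemma askey_berg_kernel_integral_pos:
  fixes k :: real
  assumes "k > 1"
  shows "(LBINT y:{0<..}. askey_berg_kernel k \<gamma> y) > 0"
proof -
  let ?h = "\<lambda>y. indicator {0<..} y *\<^sub>R askey_berg_kernel k \<gamma> y"
  have nonneg: "?h y \<ge> 0" for y
    using askey_berg_kernel_pos[OF assms, of y \<gamma>] by (simp add: indicator_def less_imp_le)
  \<comment> \<open>A nonnegative function with integral 0 vanishes almost everywhere, but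
    \<open>?h\<close> is positive on \<open>{0<..1}\<close>, a set of measure 1.\<close>
  have "integral\<^sup>L lborel ?h \<noteq> 0"
  proof
    assume "integral\<^sup>L lborel ?h = 0"
    then have "AE y in lborel. ?h y = 0"
      using askey_berg_kernel_integrable[OF assms, of \<gamma>] nonneg
      by (subst (asm) integral_nonneg_eq_0_iff_AE) (auto simp: set_integrable_def)
    then have "AE y in lborel. y \<notin> {0<..1::real}"
      by eventually_elim
        (use askey_berg_kernel_pos[OF assms, of _ \<gamma>] in \<open>force simp: indicator_def\<close>)
    then have "emeasure lborel {0<..1::real} = 0"
      by (subst (asm) AE_iff_measurable[where N = "{0<..1}"]) auto
    then show False by simp
  qed
  moreover have "integral\<^sup>L lborel ?h \<ge> 0"
    using nonneg by (intro integral_nonneg_AE) simp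
  ultimately show ?thesis by (simp add: set_lebesgue_integral_def)
qed

lemma askey_berg_density_pos_prob_density:
  fixes k \<gamma> :: real
  assumes "k > 1"
  shows "pos_prob_density (askey_berg_density k \<gamma>)"
  using askey_berg_kernel_pos[OF assms, of _ \<gamma>] askey_berg_kernel_integrable[OF assms, of \<gamma>]
    askey_berg_kernel_integral_pos[OF assms, of \<gamma>]
  by (simp add: pos_prob_density_def askey_berg_density_def[abs_def] less_imp_le)

theorem mainTheorem3:
  fixes k \<gamma> :: real
  assumes "k > 1" and "2 * \<gamma> \<in> \<int>"
  shows "doubly_symmetric (askey_berg_density k \<gamma>)
    \<and> log_symmetric (k powr \<gamma>) (askey_berg_density k \<gamma>)
    \<and> R_symmetric (k powr (\<gamma> - 1)) (askey_berg_density k \<gamma>)"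
proof -
  have "2 * (\<gamma> - 1) = 2 * \<gamma> - 2" by simp
  with assms(2) have "2 * (\<gamma> - 1) \<in> \<int>" by (metis Ints_diff Ints_numeral)
  \<comment> \<open>The normalising constant is the same on both sides, so the kernel identity at
    \<open>c = \<gamma> - 1\<close>, and below at \<open>c = \<gamma>\<close>, carries over to the
    density.\<close>
  then have "R_symmetric (k powr (\<gamma> - 1)) (askey_berg_density k \<gamma>)"
    using assms(1) askey_berg_density_pos_prob_density[OF assms(1), of \<gamma>]
      askey_berg_kernel_reflect[of k _ "\<gamma> - 1" \<gamma>]
    by (simp add: R_symmetric_def askey_berg_density_def)
  moreover have "log_symmetric (k powr \<gamma>) (askey_berg_density k \<gamma>)"
    using assms askey_berg_density_pos_prob_density[OF assms(1), of \<gamma>]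
      askey_berg_kernel_reflect[of k _ \<gamma> \<gamma>]
    by (simp add: log_symmetric_def askey_berg_density_def)
  ultimately show ?thesis unfolding doubly_symmetric_def by blast
qed

end
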